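(* Let $\lambda_f,\lambda_b>0$ and let $\xi_W^*(z)=\frac{\lambda_b}{\lambda_f+\lambda_b}\left(\frac{\lambda_f}{\lambda_f+\lambda_b}\right)^z$, $z\in\mathcal{Z}$. Let $\xi\in\mathcal{M}_1(\mathcal{Z})$ be such that $\sum_{z}z\,\xi(z)<\infty$ and $\sum_z (z\log z)\,\xi(z)=\infty$. Then $I(\xi\|\xi_W^* )<\infty$ and $V_W(\xi)=\infty$. In particular, $V_W\ne I(\cdot\|\xi_W^* )$ as functions on $\mathcal{M}_1(\mathcal{Z})$.
   Context: $\mathcal{Z}=\{0,1,2,\dots\}$; $\mathcal{M}_1(\mathcal{Z})$ is the set of probability measures on $\mathcal{Z}$ with the total variation metric; $0\log0=0$. Relative entropy: $I(\zeta\|\nu)=\sum_z\zeta(z)\log(\zeta(z)/\nu(z))$ if $\zeta\ll\nu$, and $\infty$ otherwise. Let $\mathcal{E}_W=\{(z,z+1):z\in\mathcal{Z}\}\cup\{(z,0):z\in\mathcal{Z}\setminus\{0\}\}$ with constant rates $\lambda_{z,z+1}=\lambda_f$ and $\lambda_{z,0}=\lambda_b$, and $L^Wf(z)=\sum_{z':(z,z')\in\mathcal{E}_W}\lambda_{z,z'}(f(z')-f(z))$. $\xi_W^*$ is its invariant probability measure. Let $\tau(u)=e^u-u-1$ and let $C_0^1([0,T]\times\mathcal{Z})$ be the real functions on $[0,T]\times\mathcal{Z}$ with compact support (i.e. vanishing for all $z$ outside a finite set) that are continuously differentiable in the first argument. For $\varphi\in D([0,T],\mathcal{M}_1(\mathcal{Z}))$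 (right-continuous paths with left limits) with $\varphi_0=\nu$, $$S^W_{[0,T]}(\varphi|\nu)=\sup_{f\in C_0^1([0,T]\times\mathcal{Z})}\Big\{\langle\varphi_T,f_T\rangle-\langle\varphi_0,f_0\rangle-\int_0^T\langle\varphi_u,\partial_uf_u\rangle du-\int_0^T\langle\varphi_u,L^Wf_u\rangle du-\int_0^T\sum_{(z,z')\in\mathcal{E}_W}\tau(f_u(z')-f_u(z))\lambda_{z,z'}\varphi_u(z)\,du\Big\},$$ where $\langle\xi,f\rangle=\sum_z\xi(z)f(z)$. The quasipotential is $$V_W(\xi)=\inf\{S^W_{[0,T]}(\varphi|\xi_W^* ):\varphi_0=\xi_W^*,\ \varphi_T=\xi,\ T>0\},$$ the infimum being over all $T>0$ and $\varphi\in D([0,T],\mathcal{M}_1(\mathcal{Z}))$ (with $\inf\emptyset=\infty$). *)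

theory Defs
  imports "HOL-Probability.Probability"
begin

text \<open>
  The state space \<open>\<Z>\<close> of the text is the type \<^typ>\<open>nat\<close>, and \<open>M\<^sub>1(\<Z>)\<close> is \<^typ>\<open>nat pmf\<close>.
\<close>

definition tv_dist :: "'a pmf \<Rightarrow> 'a pmf \<Rightarrow> real" where
  "tv_dist \<mu> \<nu> = (SUP A. \<bar>measure (measure_pmf \<mu>) A - measure (measure_pmf \<nu>) A\<bar>)"

text \<open>
  The sum of \<open>\<zeta>(z) log (\<zeta>(z) / \<nu>(z))\<close> is the sum of its positive parts minus the sum of its
  negative parts (\<^const>\<open>ennreal\<close> sends negative reals to 0). The latter is always finite, because
  \<open>x log x \<ge> -1/e\<close>, so the difference is never \<open>\<infinity> - \<infinity>\<close>. Terms with \<open>\<zeta>(z) = 0\<close> vanish.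
\<close>

definition rel_entropy :: "nat pmf \<Rightarrow> nat pmf \<Rightarrow> ereal" where
  "rel_entropy \<zeta> \<nu> =
     (if absolutely_continuous (measure_pmf \<nu>) (measure_pmf \<zeta>)
      then enn2ereal (\<Sum>z. ennreal (pmf \<zeta> z * ln (pmf \<zeta> z / pmf \<nu> z)))
         - enn2ereal (\<Sum>z. ennreal (- (pmf \<zeta> z * ln (pmf \<zeta> z / pmf \<nu> z))))
      else \<infinity>)"

definition pairing :: "nat pmf \<Rightarrow> (nat \<Rightarrow> real) \<Rightarrow> real" where
  "pairing \<xi> f = (\<Sum>\<^sub>\<infinity>z. pmf \<xi> z * f z)"

definition edges :: "(nat \<times> nat) set" where
  "edges = {(z, z + 1) | z. True} \<union> {(z, 0) | z. z \<noteq> 0}"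

text \<open>Only meaningful on \<^const>\<open>edges\<close>, where every edge not of the form \<open>(z, z + 1)\<close> ends in 0.\<close>

definition rate :: "real \<Rightarrow> real \<Rightarrow> nat \<Rightarrow> nat \<Rightarrow> real" where
  "rate lf lb z z' = (if z' = z + 1 then lf else lb)"

definition gen :: "real \<Rightarrow> real \<Rightarrow> (nat \<Rightarrow> real) \<Rightarrow> nat \<Rightarrow> real" where
  "gen lf lb f z = (\<Sum>z' | (z, z') \<in> edges. rate lf lb z z' * (f z' - f z))"

text \<open>
  The law with \<open>\<xi>(z) = lb / (lf + lb) * (lf / (lf + lb)) ^ z\<close>; see \<open>pmf_xi_W\<close> for the formula and
  \<open>invariant_iff\<close> for the fact that it is the unique invariant law of \<^const>\<open>gen\<close>.
\<close>

definition xi_W :: "real \<Rightarrow> real \<Rightarrow> nat pmf" where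
  "xi_W lf lb = geometric_pmf (lb / (lf + lb))"

definition invariant :: "real \<Rightarrow> real \<Rightarrow> nat pmf \<Rightarrow> bool" where
  "invariant lf lb \<nu> \<longleftrightarrow> (\<forall>f. finite {z. f z \<noteq> 0} \<longrightarrow> pairing \<nu> (gen lf lb f) = 0)"

definition tau :: "real \<Rightarrow> real" where
  "tau u = exp u - u - 1"

text \<open>
  Paths and test functions are total in time; only their values on \<open>[0, T]\<close> are ever used. In
  particular, derivatives are taken within \<open>[0, T]\<close>, hence one-sided at the endpoints.
\<close>

definition time_deriv :: "real \<Rightarrow> (real \<Rightarrow> nat \<Rightarrow> real) \<Rightarrow> real \<Rightarrow> nat \<Rightarrow> real" where
  "time_deriv T f u z = vector_derivative (\<lambda>s. f s z) (at u within {0..T})"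

definition test_functions :: "real \<Rightarrow> (real \<Rightarrow> nat \<Rightarrow> real) set" where
  "test_functions T =
     {f. (\<exists>K. finite K \<and> (\<forall>u\<in>{0..T}. \<forall>z. z \<notin> K \<longrightarrow> f u z = 0)) \<and>
         (\<forall>z. (\<lambda>u. f u z) differentiable_on {0..T} \<and>
              continuous_on {0..T} (\<lambda>u. time_deriv T f u z))}"

definition D_paths :: "real \<Rightarrow> (real \<Rightarrow> nat pmf) set" where
  "D_paths T =
     {\<phi>. (\<forall>t\<in>{0..<T}. ((\<lambda>s. tv_dist (\<phi> s) (\<phi> t)) \<longlongrightarrow> 0) (at_right t)) \<and>
         (\<forall>t\<in>{0<..T}. \<exists>\<mu>. ((\<lambda>s. tv_dist (\<phi> s) \<mu>) \<longlongrightarrow> 0) (at_left t))}"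

text \<open>The functional is only used for paths started at \<open>\<nu>\<close>; it is set to \<open>\<infinity>\<close> otherwise.\<close>

definition S_W :: "real \<Rightarrow> real \<Rightarrow> real \<Rightarrow> (real \<Rightarrow> nat pmf) \<Rightarrow> nat pmf \<Rightarrow> ereal" where
  "S_W lf lb T \<phi> \<nu> =
     (if \<phi> 0 = \<nu> then
        (SUP f\<in>test_functions T. ereal
          (pairing (\<phi> T) (f T) - pairing (\<phi> 0) (f 0)
           - (LBINT u:{0..T}. pairing (\<phi> u) (time_deriv T f u))
           - (LBINT u:{0..T}. pairing (\<phi> u) (gen lf lb (f u)))
           - (LBINT u:{0..T}.
                (\<Sum>\<^sub>\<infinity>(z, z')\<in>edges. tau (f u z' - f u z) * rate lf lb z z' * pmf (\<phi> u) z))))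
      else \<infinity>)"

definition V_W :: "real \<Rightarrow> real \<Rightarrow> nat pmf \<Rightarrow> ereal" where
  "V_W lf lb \<xi> =
     Inf {S_W lf lb T \<phi> (xi_W lf lb) | T \<phi>.
            T > 0 \<and> \<phi> \<in> D_paths T \<and> \<phi> 0 = xi_W lf lb \<and> \<phi> T = \<xi>}"

lemma pmf_xi_W:
  assumes "lf > 0" "lb > 0"
  shows "pmf (xi_W lf lb) z = lb / (lf + lb) * (lf / (lf + lb)) ^ z"
proof -
  have "1 - lb / (lf + lb) = lf / (lf + lb)" "lb / (lf + lb) \<le> 1" "lb / (lf + lb) > 0"
    using assms by (auto simp: field_simps)
  then show ?thesis
    unfolding xi_W_def by (subst pmf_geometric) auto
qed

lemma gen_eq: "gen lf lb f z = lf * (f (z + 1) - f z) + lb * (f 0 - f z)"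
proof (cases "z = 0")
  case True
  have "{z'. (z, z') \<in> edges} = {z + 1}" using True by (auto simp: edges_def)
  then show ?thesis using True by (simp add: gen_def rate_def)
next
  case False
  have "{z'. (z, z') \<in> edges} = {z + 1, 0}" using False by (auto simp: edges_def)
  then show ?thesis using False by (simp add: gen_def rate_def)
qed

lemma pairing_gen:
  assumes fin: "finite {z. f z \<noteq> 0}"
  shows "pairing \<nu> (gen lf lb f) =
    (\<Sum>z | f z \<noteq> 0. f z * ((case z of 0 \<Rightarrow> lb | Suc y \<Rightarrow> lf * pmf \<nu> y) - (lf + lb) * pmf \<nu> z))"
proof -
  let ?A = "{z. f z \<noteq> 0}"
  let ?B = "{z. f (z + 1) \<noteq> 0}"
  have finB: "finite ?B"
    using finite_imageD[of Suc ?B] finite_subset[OF _ fin, of "Suc ` ?B"] by auto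
  have s0: "((\<lambda>z. pmf \<nu> z * f z) has_sum (\<Sum>z\<in>?A. pmf \<nu> z * f z)) UNIV"
    by (rule has_sum_finite_neutralI[OF fin]) auto
  have s1: "((\<lambda>z. pmf \<nu> z * f (z + 1)) has_sum (\<Sum>z\<in>?B. pmf \<nu> z * f (z + 1))) UNIV"
    by (rule has_sum_finite_neutralI[OF finB]) auto
  have s2: "(pmf \<nu> has_sum 1) UNIV"
  proof -
    have "pmf \<nu> summable_on UNIV"
      using pmf_abs_summable[of \<nu> UNIV] by (simp add: summable_on_def abs_summable_equivalent
        abs_summable_summable flip: abs_summable_equivalent summable_on_def)
    moreover have "infsum (pmf \<nu>) UNIV = 1"
      by (metis infsetsum_infsum infsetsum_pmf_eq_1 pmf_abs_summable subset_UNIV)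
    ultimately show ?thesis by (metis has_sum_infsum)
  qed
  have "((\<lambda>z. lf * (pmf \<nu> z * f (z + 1)) + lb * f 0 * pmf \<nu> z + (- (lf + lb)) * (pmf \<nu> z * f z)) has_sum
      lf * (\<Sum>z\<in>?B. pmf \<nu> z * f (z + 1)) + lb * f 0 * 1 + (- (lf + lb)) * (\<Sum>z\<in>?A. pmf \<nu> z * f z)) UNIV"
    by (intro has_sum_add has_sum_cmult_right s0 s1 s2)
  then have *: "pairing \<nu> (gen lf lb f) =
      lf * (\<Sum>z\<in>?B. pmf \<nu> z * f (z + 1)) + lb * f 0 - (lf + lb) * (\<Sum>z\<in>?A. pmf \<nu> z * f z)"
    unfolding pairing_def gen_eq by (intro infsumI) (simp add: algebra_simps)
  have "(\<Sum>z\<in>?A. f z * (case z of 0 \<Rightarrow> lb | Suc y \<Rightarrow> lf * pmf \<nu> y)) =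
      (\<Sum>z\<in>insert 0 (Suc ` ?B). f z * (case z of 0 \<Rightarrow> lb | Suc y \<Rightarrow> lf * pmf \<nu> y))"
    by (rule sum.mono_neutral_left) (use finB in \<open>auto simp: image_iff gr0_conv_Suc elim: not0_implies_Suc\<close>,
        metis not0_implies_Suc)
  also have "\<dots> = f 0 * lb + (\<Sum>z\<in>?B. f (Suc z) * (lf * pmf \<nu> z))"
    using finB by (subst sum.insert) (auto simp: sum.reindex)
  finally show ?thesis
    unfolding * by (simp add: right_diff_distrib sum_subtractf sum_distrib_left mult_ac)
qed

lemma invariant_iff:
  assumes "lf > 0" "lb > 0"
  shows "invariant lf lb \<nu> \<longleftrightarrow> \<nu> = xi_W lf lb"
proof
  assume inv: "invariant lf lb \<nu>"
  have bal: "(lf + lb) * pmf \<nu> z = (case z of 0 \<Rightarrow> lb | Suc y \<Rightarrow> lf * pmf \<nu> y)" for z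
  proof -
    have "{y. of_bool (y = z) \<noteq> (0::real)} = {z}" by auto
    then show ?thesis
      using inv[unfolded invariant_def, rule_format, of "\<lambda>y. of_bool (y = z)"]
      by (simp add: pairing_gen)
  qed
  have bal0: "pmf \<nu> 0 = lb / (lf + lb)"
    using bal[of 0] assms by (simp add: field_simps)
  have balSuc: "pmf \<nu> (Suc y) = lf / (lf + lb) * pmf \<nu> y" for y
    using bal[of "Suc y"] assms by (simp add: field_simps)
  have "pmf \<nu> z = lb / (lf + lb) * (lf / (lf + lb)) ^ z" for z
    by (induction z) (simp_all add: bal0 balSuc)
  then show "\<nu> = xi_W lf lb" by (intro pmf_eqI) (simp add: pmf_xi_W[OF assms])
next
  assume "\<nu> = xi_W lf lb"
  moreover have "(case z of 0 \<Rightarrow> lb | Suc y \<Rightarrow> lf * pmf (xi_W lf lb) y)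
      - (lf + lb) * pmf (xi_W lf lb) z = 0" for z
    using assms by (simp add: pmf_xi_W split: nat.split)
  ultimately show "invariant lf lb \<nu>" by (simp add: invariant_def pairing_gen)
qed

end

theory Submission
  imports Defs "HOL-Real_Asymp.Real_Asymp"
begin

text \<open>
  For a test function \<open>f\<close>, the action dominates \<open>\<langle>\<phi>\<^sub>T, f\<^sub>T\<rangle> - \<langle>\<phi>\<^sub>0, f\<^sub>0\<rangle> - C T\<close> as soon as
  \<open>\<partial>\<^sub>u f + H f \<le> C\<close>, where \<open>H\<close> is the exponential Hamiltonian of the chain. This holds for
  \<open>f\<^sub>u(z) = (z log z) / 2 + (T - u) z\<close>: the upward jumps contribute \<open>O(\<surd>z)\<close> to \<open>H f\<close>, which is
  absorbed by \<open>\<partial>\<^sub>u f = -z\<close>. Cutting \<open>f\<close> off to 0 beyond \<open>N\<close> only creates downward jumps, hence keeps the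
  inequality with the same \<open>C\<close>. As \<open>f\<^sub>0\<close> is integrable under the geometric law, letting \<open>N\<close> tend to
  infinity shows that finite action forces \<open>\<langle>\<phi>\<^sub>T, z log z\<rangle> < \<infinity>\<close>. The relative entropy, in contrast,
  is controlled by the first moment, since \<open>- log \<xi>\<^sub>W\<^sup>*(z)\<close> is affine in \<open>z\<close>.
\<close>

section \<open>Measurability and integrability along right-continuous paths\<close>

text \<open>\<open>g\<close> is the pointwise limit of step functions that evaluate it at the next
  grid point to the right, capped at \<open>T\<close>.\<close>

lemma borel_measurable_right_continuous_on_Icc:
  fixes g :: "real \<Rightarrow> real"
  assumes rc: "\<And>t. t \<in> {0..<T} \<Longrightarrow> (g \<longlongrightarrow> g t) (at_right t)"
  shows "set_borel_measurable borel {0..T} g"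
proof -
  \<comment> \<open>Taking floor plus 1 instead of a ceiling keeps \<open>s n t\<close> strictly
    right of \<open>t < T\<close>, as \<open>at_right\<close> demands; the cap makes
    \<open>s n T = T\<close>, so the endpoint value is exact.\<close>
  define s where "s n t = min T (of_int (\<lfloor>real (Suc n) * t\<rfloor> + 1) / real (Suc n))" for n t
  \<comment> \<open>The composite depends on \<open>t\<close> only through the integer floor, and
    every function of an integer is measurable, so \<open>g\<close> may be arbitrary here.\<close>
  have "(\<lambda>t. g (min T (of_int (\<lfloor>real (Suc n) * t\<rfloor> + 1) / real (Suc n)))) \<in> borel_measurable borel" for n
    by (rule measurable_compose[where N = "count_space UNIV" and f = "\<lambda>t. \<lfloor>real (Suc n) * t\<rfloor>"
          and g = "\<lambda>k. g (min T (of_int (k + 1) / real (Suc n)))"]) measurable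
  then have meas: "(\<lambda>t. indicator {0..T} t * g (s n t)) \<in> borel_measurable borel" for n
    unfolding s_def by measurable
  have lim: "(\<lambda>n. indicator {0..T} t * g (s n t)) \<longlonglongrightarrow> indicator {0..T} t * g t" for t
  proof (cases "t \<in> {0..<T}")
    case True
    have gt: "t < s n t" for n
    proof -
      have "real (Suc n) * t < of_int (\<lfloor>real (Suc n) * t\<rfloor> + 1)" by linarith
      then show ?thesis using True by (simp add: s_def field_simps)
    qed
    have le: "s n t \<le> t + inverse (real (Suc n))" for n
    proof -
      have "of_int (\<lfloor>real (Suc n) * t\<rfloor> + 1) \<le> real (Suc n) * t + 1" by linarith
      then have "of_int (\<lfloor>real (Suc n) * t\<rfloor> + 1) / real (Suc n) \<le> (real (Suc n) * t + 1) / real (Suc n)"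
        by (intro divide_right_mono) auto
      also have "\<dots> = t + inverse (real (Suc n))" by (simp add: field_simps)
      finally show ?thesis by (simp add: s_def)
    qed
    have "(\<lambda>n. s n t) \<longlonglongrightarrow> t"
      by (rule real_tendsto_sandwich[OF always_eventually always_eventually tendsto_const
            LIMSEQ_inverse_real_of_nat_add]) (use gt le less_imp_le in blast)+
    moreover have "s n t \<noteq> t" for n using gt[of n] by simp
    ultimately have "filterlim (\<lambda>n. s n t) (at_right t) sequentially"
      using gt by (simp add: filterlim_at)
    then show ?thesis
      by (intro tendsto_intros filterlim_compose[OF rc[OF True]])
  next
    case False
    show ?thesis
    proof (cases "t = T \<and> 0 \<le> T")
      case True
      have "s n T = T" for n
      proof -
        have "real (Suc n) * T < of_int (\<lfloor>real (Suc n) * T\<rfloor> + 1)" by linarith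
        then have "T < of_int (\<lfloor>real (Suc n) * T\<rfloor> + 1) / real (Suc n)" 
          by (simp add: field_simps)
        then show ?thesis by (simp add: s_def)
      qed
      then show ?thesis using True by simp
    next
      case False
      then have "t \<notin> {0..T}" using \<open>t \<notin> {0..<T}\<close> by auto
      then show ?thesis by simp
    qed
  qed
  show ?thesis
    unfolding set_borel_measurable_def real_scaleR_def
    by (rule borel_measurable_LIMSEQ_real[OF lim meas])
qed

text \<open>The singleton of \<open>z\<close> is one of the sets in the supremum, which is bounded
  by 1.\<close>

lemma abs_pmf_diff_le_tv_dist: "\<bar>pmf \<mu> z - pmf \<nu> z\<bar> \<le> tv_dist \<mu> \<nu>"
proof -
  have "bdd_above (range (\<lambda>A. \<bar>measure (measure_pmf \<mu>) A - measure (measure_pmf \<nu>) A\<bar>))"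
  proof (rule bdd_aboveI2)
    fix A
    have "0 \<le> measure (measure_pmf \<mu>) A" "measure (measure_pmf \<mu>) A \<le> 1"
      "0 \<le> measure (measure_pmf \<nu>) A" "measure (measure_pmf \<nu>) A \<le> 1" by simp_all
    then show "\<bar>measure (measure_pmf \<mu>) A - measure (measure_pmf \<nu>) A\<bar> \<le> 1" by linarith
  qed
  then show ?thesis
    unfolding tv_dist_def by (rule cSUP_upper2[where x = "{z}"]) (simp_all add: measure_pmf_single)
qed

text \<open>Right-continuity in total variation passes to each coordinate and makes it measurable;
  since point masses are at most 1, \<open>h\<close> dominates the product.\<close>

lemma set_integrable_pmf_path:
  assumes "\<phi> \<in> D_paths T" and h: "continuous_on {0..T} h"
  shows "set_integrable lborel {0..T} (\<lambda>u. pmf (\<phi> u) z * h u)"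
proof (rule set_integrable_bound)
  show "set_integrable lborel {0..T} h"
    by (rule borel_integrable_compact[OF _ h, folded set_integrable_def]) simp
  have "((\<lambda>s. pmf (\<phi> s) z) \<longlongrightarrow> pmf (\<phi> t) z) (at_right t)" if "t \<in> {0..<T}" for t
  proof -
    have "((\<lambda>s. tv_dist (\<phi> s) (\<phi> t)) \<longlongrightarrow> 0) (at_right t)"
      using assms that by (auto simp: D_paths_def)
    then have "((\<lambda>s. pmf (\<phi> s) z - pmf (\<phi> t) z) \<longlongrightarrow> 0) (at_right t)"
      by (rule Lim_null_comparison[rotated]) (simp add: abs_pmf_diff_le_tv_dist)
    then show ?thesis by (simp add: LIM_zero_iff)
  qed
  then have "set_borel_measurable borel {0..T} (\<lambda>u. pmf (\<phi> u) z)"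
    by (rule borel_measurable_right_continuous_on_Icc)
  moreover have "set_borel_measurable borel {0..T} h"
    unfolding set_borel_measurable_def
    using borel_measurable_continuous_on_indicator[OF _ h] by simp
  ultimately have "(\<lambda>u. (indicator {0..T} u * pmf (\<phi> u) z) * (indicator {0..T} u * h u)) \<in> borel_measurable borel"
    unfolding set_borel_measurable_def real_scaleR_def by (rule borel_measurable_times)
  then show "set_borel_measurable lborel {0..T} (\<lambda>u. pmf (\<phi> u) z * h u)"
    unfolding set_borel_measurable_def measurable_lborel1 measurable_lborel2
      by (rule measurable_cong[THEN iffD1, rotated]) (auto simp: indicator_def)
  show "AE u in lborel. u \<in> {0..T} \<longrightarrow> norm (pmf (\<phi> u) z * h u) \<le> norm (h u)"
    by (auto simp: abs_mult pmf_le_1 intro!: mult_left_le_one_le)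
qed

section \<open>Reduction of the action to finite sums, and its lower bound\<close>

lemma pairing_eq_sum:
  assumes "\<And>z. z > N \<Longrightarrow> f z = 0"
  shows "pairing \<mu> f = (\<Sum>z\<le>N. pmf \<mu> z * f z)"
proof -
  have "pairing \<mu> f = infsum (\<lambda>z. pmf \<mu> z * f z) {..N}"
    unfolding pairing_def using assms by (intro infsum_cong_neutral) auto
  then show ?thesis by simp
qed

text \<open>Edges leaving a state beyond \<open>N\<close> join two zeros of \<open>f\<close>, the
  resets because \<open>f 0 = 0\<close>, and \<open>tau 0 = 0\<close>.\<close>

lemma infsum_edges_tau_eq_sum:
  assumes "\<And>z. z > N \<Longrightarrow> f z = 0" and "f 0 = 0"
  shows "(\<Sum>\<^sub>\<infinity>(z, z')\<in>edges. tau (f z' - f z) * rate lf lb z z' * pmf \<mu> z)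
    = (\<Sum>z\<le>N. pmf \<mu> z * (lf * tau (f (z + 1) - f z) + lb * tau (- f z)))"
proof -
  let ?g = "\<lambda>(z, z'). tau (f z' - f z) * rate lf lb z z' * pmf \<mu> z"
  let ?A = "(\<lambda>z. (z, z + 1)) ` {..N}" and ?B = "(\<lambda>z. (z, 0::nat)) ` {0<..N}"
  have "tau (f z' - f z) = 0" if e: "(z, z') \<in> edges" and A: "(z, z') \<notin> ?A" and B: "(z, z') \<notin> ?B" for z z'
  proof (cases "z' = z + 1")
    case True
    then have "N < z" using A by (simp add: image_iff)
    then show ?thesis using assms True by (simp add: tau_def)
  next
    case False
    then have "z' = 0" "N < z" using e B by (auto simp: edges_def image_iff)
    then show ?thesis using assms by (simp add: tau_def)
  qed
  moreover have "?A \<union> ?B \<subseteq> edges" by (auto simp: edges_def)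
  ultimately have "infsum ?g edges = infsum ?g (?A \<union> ?B)"
    by (intro infsum_cong_neutral) auto
  also have "\<dots> = sum ?g ?A + sum ?g ?B"
    by (simp, subst sum.union_disjoint) auto
  also have "sum ?g ?A = (\<Sum>z\<le>N. pmf \<mu> z * (lf * tau (f (z + 1) - f z)))"
    by (subst sum.reindex) (auto simp: inj_on_def rate_def mult_ac)
  also have "sum ?g ?B = (\<Sum>z\<in>{0<..N}. pmf \<mu> z * (lb * tau (- f z)))"
    using assms by (subst sum.reindex) (auto simp: inj_on_def rate_def mult_ac)
  \<comment> \<open>State 0 has no reset edge, but its term would be \<open>tau 0 = 0\<close>, so it
    can be added.\<close>
  also have "\<dots> = (\<Sum>z\<le>N. pmf \<mu> z * (lb * tau (- f z)))"
    using assms by (intro sum.mono_neutral_left) (auto simp: tau_def)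
  finally show ?thesis by (simp add: sum.distrib distrib_left)
qed

text \<open>
  The generator and \<^const>\<open>tau\<close> terms add up to the exponential Hamiltonian
  \<open>lf * (exp (f (z + 1) - f z) - 1) + lb * (exp (f 0 - f z) - 1)\<close>.
\<close>

lemma S_W_ge_subsolution:
  assumes T: "T > 0" and \<phi>: "\<phi> \<in> D_paths T" and f: "f \<in> test_functions T"
    and supp: "\<And>u z. u \<in> {0..T} \<Longrightarrow> z > N \<Longrightarrow> f u z = 0"
    and f0: "\<And>u. u \<in> {0..T} \<Longrightarrow> f u 0 = 0"
    and sub: "\<And>u z. u \<in> {0..T} \<Longrightarrow> z \<le> N \<Longrightarrow>
      time_deriv T f u z + lf * (exp (f u (z + 1) - f u z) - 1) + lb * (exp (- f u z) - 1) \<le> C"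
    and C: "C \<ge> 0"
  shows "S_W lf lb T \<phi> (\<phi> 0) \<ge> pairing (\<phi> T) (f T) - pairing (\<phi> 0) (f 0) - C * T"
proof -
  let ?D = "\<lambda>u. \<Sum>z\<le>N. pmf (\<phi> u) z * time_deriv T f u z"
  let ?L = "\<lambda>u. \<Sum>z\<le>N. pmf (\<phi> u) z * (lf * (f u (z + 1) - f u z) - lb * f u z)"
  let ?H = "\<lambda>u. \<Sum>z\<le>N. pmf (\<phi> u) z * (lf * tau (f u (z + 1) - f u z) + lb * tau (- f u z))"
  have cont: "continuous_on {0..T} (\<lambda>u. f u z)" for z
    using f by (auto simp: test_functions_def intro: differentiable_imp_continuous_on)
  have cont_deriv: "continuous_on {0..T} (\<lambda>u. time_deriv T f u z)" for z
    using f by (auto simp: test_functions_def)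
  have int: "set_integrable lborel {0..T} (\<lambda>u. \<Sum>z\<le>N. pmf (\<phi> u) z * h u z)"
    if "\<And>z. continuous_on {0..T} (\<lambda>u. h u z)" for h
    unfolding set_integrable_def scaleR_sum_right
    by (intro Bochner_Integration.integrable_sum
        set_integrable_pmf_path[OF \<phi> that, unfolded set_integrable_def])
  have intD: "set_integrable lborel {0..T} ?D"
    by (intro int cont_deriv)
  have intL: "set_integrable lborel {0..T} ?L"
    by (intro int continuous_intros cont)
  have intH: "set_integrable lborel {0..T} ?H"
    unfolding tau_def by (intro int continuous_intros cont)
  \<comment> \<open>\<open>f\<close> vanishes at \<open>z\<close> throughout the interval, and
    \<open>T > 0\<close> makes the derivative within it unique, also at the endpoints.\<close>
  have deriv0: "time_deriv T f u z = 0" if u: "u \<in> {0..T}" and z: "z > N" for u z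
  proof -
    have "((\<lambda>s. f s z) has_vector_derivative 0) (at u within {0..T})"
      by (rule has_vector_derivative_transform[OF u _ has_vector_derivative_const[where c = 0]])
        (simp add: supp z)
    then show ?thesis
      unfolding time_deriv_def using T u vector_derivative_within_cbox[of 0 T u] by (auto simp: cbox_interval)
  qed
  have eD: "(LBINT u:{0..T}. pairing (\<phi> u) (time_deriv T f u)) = (LBINT u:{0..T}. ?D u)"
    by (intro set_lebesgue_integral_cong) (auto intro!: pairing_eq_sum deriv0)
  have eL: "(LBINT u:{0..T}. pairing (\<phi> u) (gen lf lb (f u))) = (LBINT u:{0..T}. ?L u)"
  proof (intro set_lebesgue_integral_cong allI impI)
    fix u assume u: "u \<in> {0..T}"
    \<comment> \<open>For \<open>z > N\<close> the upward jump joins two zeros and the reset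
      contributes \<open>lb * f u 0 = 0\<close>, so \<open>gen\<close> creates no value beyond
      \<open>N\<close>.\<close>
    have "pairing (\<phi> u) (gen lf lb (f u)) = (\<Sum>z\<le>N. pmf (\<phi> u) z * gen lf lb (f u) z)"
      using supp[OF u] f0[OF u] by (intro pairing_eq_sum) (simp add: gen_eq)
    then show "pairing (\<phi> u) (gen lf lb (f u)) = ?L u"
      using f0[OF u] by (simp add: gen_eq)
  qed simp
  have eH: "(LBINT u:{0..T}. (\<Sum>\<^sub>\<infinity>(z, z')\<in>edges. tau (f u z' - f u z) * rate lf lb z z' * pmf (\<phi> u) z))
      = (LBINT u:{0..T}. ?H u)"
    by (intro set_lebesgue_integral_cong allI impI infsum_edges_tau_eq_sum supp f0) auto
  have "(LBINT u:{0..T}. ?D u) + (LBINT u:{0..T}. ?L u) + (LBINT u:{0..T}. ?H u)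
      = (LBINT u:{0..T}. ?D u + ?L u + ?H u)"
    using intD intL intH by simp
  also have "\<dots> \<le> (LBINT u:{0..T}. C)"
  proof (rule set_integral_mono)
    show "set_integrable lborel {0..T} (\<lambda>u. ?D u + ?L u + ?H u)"
      using intD intL intH by simp
    show "set_integrable lborel {0..T} (\<lambda>u. C)"
      by (intro borel_integrable_compact[folded set_integrable_def]) auto
    fix u assume u: "u \<in> {0..T}"
    have "?D u + ?L u + ?H u = (\<Sum>z\<le>N. pmf (\<phi> u) z *
        (time_deriv T f u z + lf * (exp (f u (z + 1) - f u z) - 1) + lb * (exp (- f u z) - 1)))"
      unfolding sum.distrib[symmetric] by (intro sum.cong) (simp_all add: tau_def algebra_simps)
    also have "\<dots> \<le> (\<Sum>z\<le>N. pmf (\<phi> u) z * C)"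
      by (intro sum_mono mult_left_mono sub[OF u]) auto
    \<comment> \<open>Only the mass of \<open>{..N}\<close> is collected; it is at most 1, and
      \<open>C \<ge> 0\<close> turns this into the bound \<open>C\<close>.\<close>
    also have "\<dots> = measure (measure_pmf (\<phi> u)) {..N} * C"
      by (simp add: measure_measure_pmf_finite sum_distrib_right)
    also have "\<dots> \<le> 1 * C"
      using C by (intro mult_right_mono) auto
    finally show "?D u + ?L u + ?H u \<le> C" by simp
  qed
  also have "\<dots> = C * T"
    using T by (simp add: set_lebesgue_integral_def)
  finally have le: "pairing (\<phi> T) (f T) - pairing (\<phi> 0) (f 0) - C * T \<le>
      pairing (\<phi> T) (f T) - pairing (\<phi> 0) (f 0) - (LBINT u:{0..T}. ?D u)
        - (LBINT u:{0..T}. ?L u) - (LBINT u:{0..T}. ?H u)"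
    by simp
  show ?thesis
    unfolding S_W_def by (simp only: if_True refl, rule SUP_upper2[OF f]) (use le eD eL eH in simp)
qed

section \<open>The entropy test function and its Hamiltonian inequality\<close>

text \<open>For \<open>z > 0\<close> the increment is
  \<open>ln (z + 1) + z * ln (1 + 1 / z)\<close>, and \<open>ln x \<le> x - 1\<close> bounds the
  second term by 1.\<close>

lemma Suc_mult_ln_diff_le: "real (z + 1) * ln (real (z + 1)) - real z * ln (real z) \<le> ln (real (z + 1)) + 1"
proof (cases "z = 0")
  case False
  then have "ln (real (z + 1)) - ln (real z) \<le> real (z + 1) / real z - 1"
    by (subst ln_divide_pos[symmetric]) (auto intro!: ln_le_minus_one)
  then have "real z * (ln (real (z + 1)) - ln (real z)) \<le> real z * (real (z + 1) / real z - 1)"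
    by (intro mult_left_mono) auto
  also have "\<dots> = 1" using False by (simp add: field_simps)
  finally show ?thesis by (simp add: algebra_simps)
qed simp

text \<open>A coefficient \<open>c\<close> in \<open>(0, 1)\<close> on \<open>z * ln z\<close> makes
  upward jumps contribute order \<open>z\<close> to the power \<open>c\<close>, which is sublinear;
  \<open>c = 1/2\<close> gives a square root. The linear term vanishes at
  \<open>u = T\<close>.\<close>

definition entropy_test :: "nat \<Rightarrow> real \<Rightarrow> real \<Rightarrow> nat \<Rightarrow> real" where
  "entropy_test N T u z = (if z \<le> N then real z * ln (real z) / 2 + (T - u) * real z else 0)"

lemma time_deriv_entropy_test:
  assumes "T > 0" "u \<in> {0..T}"
  shows "time_deriv T (entropy_test N T) u z = (if z \<le> N then - real z else 0)"
proof -
  have "((\<lambda>s. entropy_test N T s z) has_vector_derivative (if z \<le> N then - real z else 0)) (at u within {0..T})"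
    unfolding entropy_test_def has_real_derivative_iff_has_vector_derivative[symmetric]
    by (auto intro!: derivative_eq_intros)
  then show ?thesis
    unfolding time_deriv_def using assms vector_derivative_within_cbox[of 0 T u] by (auto simp: cbox_interval)
qed

lemma entropy_test_in_test_functions:
  assumes "T > 0"
  shows "entropy_test N T \<in> test_functions T"
  unfolding test_functions_def
proof (intro CollectI conjI exI[of _ "{..N}"] allI)
  fix z
  show "(\<lambda>u. entropy_test N T u z) differentiable_on {0..T}"
    unfolding entropy_test_def by (cases "z \<le> N") (auto intro!: derivative_intros simp: differentiable_on_def)
  show "continuous_on {0..T} (\<lambda>u. time_deriv T (entropy_test N T) u z)"
    by (subst continuous_on_cong[OF refl time_deriv_entropy_test[OF assms]]) auto
qed (auto simp: entropy_test_def)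

text \<open>This makes jumps to value 0, by reset or across the cut-off, non-increasing in the test
  function.\<close>

lemma entropy_test_nonneg: "u \<le> T \<Longrightarrow> 0 \<le> entropy_test N T u z"
  by (cases "z = 0") (auto simp: entropy_test_def)

text \<open>The upward term is at most \<open>z + 1 + B\<^sup>2\<close>, whose \<open>z\<close>
  cancels against the time derivative. The resulting constant does not depend on
  \<open>N\<close>.\<close>

lemma entropy_test_subsolution:
  assumes pos: "lf > 0" "lb > 0" "T > 0" and u: "u \<in> {0..T}" and z: "z \<le> N"
  shows "time_deriv T (entropy_test N T) u z
      + lf * (exp (entropy_test N T u (z + 1) - entropy_test N T u z) - 1)
      + lb * (exp (- entropy_test N T u z) - 1) \<le> 1 + (lf * exp (T + 1 / 2))\<^sup>2"
proof -
  let ?d = "entropy_test N T u (z + 1) - entropy_test N T u z"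
  define B where "B = lf * exp (T + 1 / 2)"
  have "?d \<le> ln (real (z + 1)) / 2 + (T + 1 / 2)"
  proof (cases "z + 1 \<le> N")
    case True
    then have "?d = (real (z + 1) * ln (real (z + 1)) - real z * ln (real z)) / 2 + (T - u)"
      by (simp add: entropy_test_def algebra_simps add_divide_distrib diff_divide_distrib)
    then show ?thesis using Suc_mult_ln_diff_le[of z] u unfolding atLeastAtMost_iff by argo
  next
    case False
    \<comment> \<open>Here \<open>z = N\<close>: the jump crosses the cut-off and lands on value
      0.\<close>
    then have "?d \<le> 0" using entropy_test_nonneg[of u T N z] u by (simp add: entropy_test_def)
    moreover have "0 \<le> ln (real (z + 1))" by simp
    ultimately show ?thesis using pos by linarith
  qed
  then have "lf * exp ?d \<le> lf * exp (ln (real (z + 1)) / 2 + (T + 1 / 2))"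
    using pos by simp
  also have "\<dots> = B * sqrt (real (z + 1))"
  proof -
    have "exp (ln (real (z + 1)) / 2) = sqrt (real (z + 1))"
      by (subst ln_sqrt[symmetric]) simp_all
    then show ?thesis
      unfolding B_def exp_add[of "ln (real (z + 1)) / 2"] by (simp only: mult_ac)
  qed
  also have "\<dots> \<le> real (z + 1) + B\<^sup>2"
  proof -
    \<comment> \<open>AM-GM; as the product is nonnegative, the factor 2 can then be
      dropped.\<close>
    have "2 * (B * sqrt (real (z + 1))) \<le> B\<^sup>2 + (sqrt (real (z + 1)))\<^sup>2"
      using sum_squares_bound[of B "sqrt (real (z + 1))"] by (simp add: mult_ac)
    moreover have "0 \<le> B * sqrt (real (z + 1))" using pos by (simp add: B_def)
    ultimately show ?thesis by simp
  qed
  finally have "lf * exp ?d \<le> real (z + 1) + B\<^sup>2" .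
  moreover have "lb * (exp (- entropy_test N T u z) - 1) \<le> 0"
    using pos u entropy_test_nonneg[of u T N z] by (intro mult_nonneg_nonpos) auto
  moreover have "time_deriv T (entropy_test N T) u z = - real z"
    using time_deriv_entropy_test[OF \<open>T > 0\<close> u] z by simp
  ultimately show ?thesis
    using \<open>lf > 0\<close> unfolding B_def[symmetric] by (simp add: algebra_simps)
qed

text \<open>This is the initial pairing without cut-off. Of the two factors
  \<open>sqrt q ^ z\<close> of \<open>q ^ z\<close>, one kills the growth and the other is a
  geometric majorant.\<close>

lemma summable_xi_W_entropy_test:
  assumes "lf > 0" "lb > 0"
  shows "summable (\<lambda>z. pmf (xi_W lf lb) z * (real z * ln (real z) / 2 + T * real z))"
proof -
  define q where "q = lf / (lf + lb)"
  have q: "0 < q" "q < 1" using assms by (auto simp: q_def)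
  have "summable (\<lambda>z. q ^ z * (real z * ln (real z) / 2 + T * real z))"
  proof (rule summable_comparison_test_ev)
    show "summable (\<lambda>z. sqrt q ^ z)"
      using q by (intro summable_geometric) simp
    have "((\<lambda>z. sqrt q ^ z * (real z * ln (real z) / 2 + T * real z)) \<longlongrightarrow> 0) sequentially"
      using q by real_asymp
    then have "eventually (\<lambda>z. \<bar>sqrt q ^ z * (real z * ln (real z) / 2 + T * real z)\<bar> < 1) sequentially"
      by (auto simp: tendsto_iff dest!: spec[of _ "1::real"])
    then show "eventually (\<lambda>z. norm (q ^ z * (real z * ln (real z) / 2 + T * real z)) \<le> sqrt q ^ z) sequentially"
    proof eventually_elim
      case (elim z)
      have "q ^ z = sqrt q ^ z * sqrt q ^ z"
        using q by (simp flip: power_mult_distrib)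
      then have "norm (q ^ z * (real z * ln (real z) / 2 + T * real z))
          = sqrt q ^ z * \<bar>sqrt q ^ z * (real z * ln (real z) / 2 + T * real z)\<bar>"
        using q by (simp add: abs_mult)
      also have "\<dots> \<le> sqrt q ^ z * 1"
        using elim q by (intro mult_left_mono) auto
      finally show ?case by simp
    qed
  qed
  then have "summable (\<lambda>z. lb / (lf + lb) * (q ^ z * (real z * ln (real z) / 2 + T * real z)))"
    by (rule summable_mult)
  then show ?thesis
    using assms by (simp add: pmf_xi_W q_def mult.assoc)
qed

section \<open>Infinite action and finite relative entropy\<close>

lemma S_W_eq_top:
  assumes pos: "lf > 0" "lb > 0" and T: "T > 0" and \<phi>: "\<phi> \<in> D_paths T"
    and init: "\<phi> 0 = xi_W lf lb"
    and ent: "(\<Sum>z. ennreal (real z * ln (real z) * pmf (\<phi> T) z)) = \<infinity>"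
  shows "S_W lf lb T \<phi> (xi_W lf lb) = \<infinity>"
proof (rule ccontr)
  assume fin: "S_W lf lb T \<phi> (xi_W lf lb) \<noteq> \<infinity>"
  define C where "C = 1 + (lf * exp (T + 1 / 2))\<^sup>2"
  define e where "e z = real z * ln (real z)" for z
  have e_nonneg: "0 \<le> e z" for z by (cases "z = 0") (auto simp: e_def)
  \<comment> \<open>A bound on the initial pairing that is uniform in \<open>N\<close>: the cut-off
    only drops nonnegative terms.\<close>
  define A where "A = (\<Sum>z. pmf (xi_W lf lb) z * (e z / 2 + T * real z))"
  have init_le: "pairing (\<phi> 0) (entropy_test N T 0) \<le> A" for N
  proof -
    have "pairing (\<phi> 0) (entropy_test N T 0) = (\<Sum>z\<le>N. pmf (xi_W lf lb) z * (e z / 2 + T * real z))"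
      unfolding init by (subst pairing_eq_sum[of N]) (auto simp: entropy_test_def e_def)
    also have "\<dots> \<le> A"
      unfolding A_def using summable_xi_W_entropy_test[OF pos, of T] T e_nonneg
      by (intro sum_le_suminf) (auto simp: e_def)
    finally show ?thesis .
  qed
  have final: "pairing (\<phi> T) (entropy_test N T T) = (\<Sum>z\<le>N. e z * pmf (\<phi> T) z) / 2" for N
    by (subst pairing_eq_sum[of N]) (auto simp: entropy_test_def e_def sum_divide_distrib intro!: sum.cong)
  have low: "ereal ((\<Sum>z\<le>N. e z * pmf (\<phi> T) z) / 2 - A - C * T) \<le> S_W lf lb T \<phi> (xi_W lf lb)" for N
  proof -
    have "ereal (pairing (\<phi> T) (entropy_test N T T) - pairing (\<phi> 0) (entropy_test N T 0) - C * T)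
        \<le> S_W lf lb T \<phi> (\<phi> 0)"
      unfolding C_def
      by (rule S_W_ge_subsolution[OF T \<phi> entropy_test_in_test_functions[OF T] _ _
            entropy_test_subsolution[OF pos T]]) (auto simp: entropy_test_def)
    moreover have "(\<Sum>z\<le>N. e z * pmf (\<phi> T) z) / 2 - A - C * T
        \<le> pairing (\<phi> T) (entropy_test N T T) - pairing (\<phi> 0) (entropy_test N T 0) - C * T"
      using init_le[of N] by (simp add: final)
    ultimately show ?thesis unfolding init by (meson ereal_less_eq(3) order_trans)
  qed
  \<comment> \<open>\<open>low[of 0]\<close> excludes minus infinity, so the action is a real
    number.\<close>
  obtain M where M: "S_W lf lb T \<phi> (xi_W lf lb) = ereal M"
    using fin low[of 0] by (cases "S_W lf lb T \<phi> (xi_W lf lb)") auto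
  have "summable (\<lambda>z. e z * pmf (\<phi> T) z)"
  proof (rule bounded_imp_summable)
    \<comment> \<open>This is \<open>low\<close> solved for the partial sum; the 2 undoes the
      coefficient 1/2 of the test function.\<close>
    show "(\<Sum>z\<le>N. e z * pmf (\<phi> T) z) \<le> 2 * (M + A + C * T)" for N
      using low[of N] unfolding M by simp
  qed (simp add: e_nonneg)
  then show False
    using ent ennreal_suminf_neq_top[of "\<lambda>z. e z * pmf (\<phi> T) z"] e_nonneg by (simp add: e_def)
qed

text \<open>As integrals, moment series can be transported along \<open>map_pmf\<close>.\<close>

lemma suminf_mult_pmf_eq_nn_integral:
  assumes "\<And>z. 0 \<le> g z"
  shows "(\<Sum>z. ennreal (g z * pmf \<xi> z)) = (\<integral>\<^sup>+z. ennreal (g z) \<partial>measure_pmf \<xi>)"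
  by (subst nn_integral_measure_pmf, subst nn_integral_count_space_nat)
    (simp add: assms ennreal_mult mult.commute)

lemma rel_entropy_xi_W_finite:
  assumes pos: "lf > 0" "lb > 0" and mean: "(\<Sum>z. ennreal (real z * pmf \<xi> z)) < \<infinity>"
  shows "rel_entropy \<xi> (xi_W lf lb) < \<infinity>"
proof -
  define p q where "p = lb / (lf + lb)" and "q = lf / (lf + lb)"
  have p: "0 < p" "p < 1" and q: "0 < q" "q < 1" using pos by (auto simp: p_def q_def)
  have xi: "pmf (xi_W lf lb) z = p * q ^ z" for z
    using pos by (simp add: pmf_xi_W p_def q_def)
  \<comment> \<open>Every state is charged, so only the empty set is null.\<close>
  have "set_pmf (xi_W lf lb) = UNIV"
    using p q by (auto simp: set_pmf_eq xi)
  then have ac: "absolutely_continuous (measure_pmf (xi_W lf lb)) (measure_pmf \<xi>)"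
    by (auto simp: absolutely_continuous_def null_sets_def measure_pmf.emeasure_eq_measure
        measure_pmf_zero_iff)
  have term_le: "pmf \<xi> z * ln (pmf \<xi> z / pmf (xi_W lf lb) z)
      \<le> - ln p * pmf \<xi> z + - ln q * (real z * pmf \<xi> z)" for z
  proof (cases "pmf \<xi> z = 0")
    case False
    then have pos: "0 < pmf \<xi> z" by (simp add: pmf_nonneg order_less_le)
    then have "ln (pmf \<xi> z / (p * q ^ z)) = ln (pmf \<xi> z) - ln p - real z * ln q"
      using p q by (simp add: ln_divide_pos ln_mult_pos ln_realpow)
    \<comment> \<open>Point masses are at most 1, so their logarithm is nonpositive.\<close>
    also have "\<dots> \<le> - ln p + - ln q * real z"
      using pos pmf_le_1[of \<xi> z] by simp
    finally have "pmf \<xi> z * ln (pmf \<xi> z / (p * q ^ z)) \<le> pmf \<xi> z * (- ln p + - ln q * real z)"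
      by (rule mult_left_mono) simp
    then show ?thesis
      unfolding xi by (simp add: algebra_simps)
  qed simp
  have s0: "summable (pmf \<xi>)"
  proof (rule summable_suminf_not_top)
    have "(\<Sum>z. ennreal (pmf \<xi> z)) = emeasure (measure_pmf \<xi>) UNIV"
      unfolding nn_integral_pmf[symmetric] nn_integral_count_space_nat ..
    also have "\<dots> = 1" by (simp add: measure_pmf.emeasure_eq_measure)
    finally show "(\<Sum>z. ennreal (pmf \<xi> z)) \<noteq> top"
      by (simp only: ennreal_one_neq_top not_False_eq_True)
  qed simp
  have s1: "summable (\<lambda>z. real z * pmf \<xi> z)"
    using mean by (intro summable_suminf_not_top) (auto simp: less_top)
  have le: "(\<Sum>z. ennreal (pmf \<xi> z * ln (pmf \<xi> z / pmf (xi_W lf lb) z)))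
      \<le> (\<Sum>z. ennreal (- ln p * pmf \<xi> z + - ln q * (real z * pmf \<xi> z)))"
    by (intro suminf_le ennreal_leI term_le) auto
  have ln: "0 \<le> - ln p" "0 \<le> - ln q" using p q by simp_all
  have "(\<Sum>z. ennreal (- ln p * pmf \<xi> z + - ln q * (real z * pmf \<xi> z))) \<noteq> top"
    by (intro ennreal_suminf_neq_top summable_add summable_mult s0 s1 add_nonneg_nonneg mult_nonneg_nonneg ln) simp_all
  then have P: "(\<Sum>z. ennreal (pmf \<xi> z * ln (pmf \<xi> z / pmf (xi_W lf lb) z))) \<noteq> top"
    using le by (metis top_unique)
  \<comment> \<open>Subtracting the negative parts cannot produce infinity, so bounding the positive
    parts is enough.\<close>
  have diff_finite: "enn2ereal a - enn2ereal b < \<infinity>" if "a \<noteq> top" for a b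
    using that by (cases a; cases b) (auto simp: enn2ereal_ennreal)
  show ?thesis
    unfolding rel_entropy_def if_P[OF ac] by (rule diff_finite[OF P])
qed

section \<open>A law separating the two functionals, and the conclusion\<close>

text \<open>Put mass proportional to \<open>1 / ((k + 1)^2 * 2^k)\<close> at \<open>2^k\<close>. The
  mean becomes a multiple of the sum of \<open>1 / (k + 1)^2\<close>, while the extra factor
  \<open>ln (2^k) = k * ln 2\<close> makes the other series diverge.\<close>

lemma exists_pmf_finite_mean_infinite_entropy:
  obtains \<xi> :: "nat pmf" where "(\<Sum>z. ennreal (real z * pmf \<xi> z)) < \<infinity>"
    and "(\<Sum>z. ennreal (real z * ln (real z) * pmf \<xi> z)) = \<infinity>"
proof -
  define w :: "nat \<Rightarrow> real" where "w k = inverse (real (Suc k)) ^ 2 / 2 ^ k" for k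
  define s where "s = suminf w"
  have sq: "summable (\<lambda>k. inverse (real (Suc k)) ^ 2)"
    using inverse_power_summable[of 2, where 'a = real] by (subst summable_Suc_iff) (simp add: power_inverse)
  have w_pos: "0 < w k" for k by (simp add: w_def)
  have "w k \<le> inverse (real (Suc k)) ^ 2" for k
    by (simp add: w_def divide_le_eq mult_left_le_one_le mult_le_cancel_left1)
  then have sw: "summable w"
    using w_pos by (intro summable_comparison_test'[OF sq, of 0]) (auto simp: less_imp_le)
  have s: "s > 0" unfolding s_def by (intro suminf_pos sw w_pos)
  define \<rho> where "\<rho> = embed_pmf (\<lambda>k. w k / s)"
  have "(\<integral>\<^sup>+k. ennreal (w k / s) \<partial>count_space UNIV) = 1"
    using s w_pos sw by (subst nn_integral_count_space_nat, subst suminf_ennreal2)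
      (auto simp: less_imp_le suminf_divide s_def[symmetric] intro!: summable_divide)
  then have \<rho>: "pmf \<rho> k = w k / s" for k
    unfolding \<rho>_def using s w_pos by (intro pmf_embed_pmf) (auto simp: less_imp_le)
  define \<xi> where "\<xi> = map_pmf (\<lambda>k. 2 ^ k :: nat) \<rho>"
  have transfer_sum: "(\<Sum>z. ennreal (g z * pmf \<xi> z)) = (\<Sum>k. ennreal (g (2 ^ k) * (w k / s)))"
    if "\<And>z. 0 \<le> g z" for g
    using suminf_mult_pmf_eq_nn_integral[of "\<lambda>k. g (2 ^ k)" \<rho>] that
    by (simp add: suminf_mult_pmf_eq_nn_integral \<xi>_def \<rho>)
  show thesis
  proof
    have "(\<Sum>k. ennreal (real (2 ^ k) * (w k / s))) \<noteq> top"
      using s sq by (intro ennreal_suminf_neq_top) (auto simp: w_def intro!: summable_divide)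
    then show "(\<Sum>z. ennreal (real z * pmf \<xi> z)) < \<infinity>"
      by (simp add: transfer_sum less_top)
    show "(\<Sum>z. ennreal (real z * ln (real z) * pmf \<xi> z)) = \<infinity>"
    proof (rule ccontr)
      have nonneg: "0 \<le> real z * ln (real z)" for z by (cases "z = 0") auto
      assume "(\<Sum>z. ennreal (real z * ln (real z) * pmf \<xi> z)) \<noteq> \<infinity>"
      then have "(\<Sum>k. ennreal (real (2 ^ k) * ln (real (2 ^ k)) * (w k / s))) \<noteq> top"
        by (subst transfer_sum[OF nonneg, symmetric]) simp
      then have "summable (\<lambda>k. real (2 ^ k) * ln (real (2 ^ k)) * (w k / s))"
        using s w_pos by (intro summable_suminf_not_top) (auto simp: less_imp_le ln_realpow)
      \<comment> \<open>The rescaled terms are \<open>k / (k + 1)^2\<close>; adding the convergent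
        \<open>1 / (k + 1)^2\<close> gives exactly the harmonic terms
        \<open>1 / (k + 1)\<close>.\<close>
      then have "summable (\<lambda>k. s / ln 2 * (real (2 ^ k) * ln (real (2 ^ k)) * (w k / s)) + inverse (real (Suc k)) ^ 2)"
        by (intro summable_add summable_mult sq)
      also have "(\<lambda>k. s / ln 2 * (real (2 ^ k) * ln (real (2 ^ k)) * (w k / s)) + inverse (real (Suc k)) ^ 2)
          = (\<lambda>k. inverse (real (Suc k)))"
      proof
        fix k
        have "s / ln 2 * (real (2 ^ k) * ln (real (2 ^ k)) * (w k / s)) + inverse (real (Suc k)) ^ 2
            = real k * inverse (real (Suc k)) ^ 2 + inverse (real (Suc k)) ^ 2"
          using s by (simp add: w_def ln_realpow del: of_nat_Suc)
        also have "\<dots> = real (Suc k) * inverse (real (Suc k)) ^ 2"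
          by (simp add: distrib_right)
        also have "\<dots> = inverse (real (Suc k))"
          by (simp add: power2_eq_square del: of_nat_Suc)
        finally show "s / ln 2 * (real (2 ^ k) * ln (real (2 ^ k)) * (w k / s)) + inverse (real (Suc k)) ^ 2
            = inverse (real (Suc k))" .
      qed
      finally show False
        using not_summable_harmonic[where 'a = real] summable_Suc_iff[of "\<lambda>k. inverse (real k)"] by simp
    qed
  qed
qed

theorem proposition8p2:
  fixes lf lb :: real
  assumes "lf > 0" and "lb > 0"
  shows "(\<forall>\<xi> :: nat pmf.
            (\<Sum>z. ennreal (real z * pmf \<xi> z)) < \<infinity> \<longrightarrow>
            (\<Sum>z. ennreal (real z * ln (real z) * pmf \<xi> z)) = \<infinity> \<longrightarrow>
            rel_entropy \<xi> (xi_W lf lb) < \<infinity> \<and> V_W lf lb \<xi> = \<infinity>)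
         \<and> V_W lf lb \<noteq> (\<lambda>\<xi>. rel_entropy \<xi> (xi_W lf lb))"
proof -
  have main: "rel_entropy \<xi> (xi_W lf lb) < \<infinity> \<and> V_W lf lb \<xi> = \<infinity>"
    if "(\<Sum>z. ennreal (real z * pmf \<xi> z)) < \<infinity>"
      and "(\<Sum>z. ennreal (real z * ln (real z) * pmf \<xi> z)) = \<infinity>" for \<xi>
  proof
    show "rel_entropy \<xi> (xi_W lf lb) < \<infinity>"
      using rel_entropy_xi_W_finite[OF assms that(1)] .
    \<comment> \<open>Stated elementwise, this also covers the case of no admissible path, where the
      infimum of the empty set is infinity.\<close>
    have "x = \<infinity>" if "x \<in> {S_W lf lb T \<phi> (xi_W lf lb) | T \<phi>.
        T > 0 \<and> \<phi> \<in> D_paths T \<and> \<phi> 0 = xi_W lf lb \<and> \<phi> T = \<xi>}" for x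
      using that S_W_eq_top[OF assms] \<open>(\<Sum>z. ennreal (real z * ln (real z) * pmf \<xi> z)) = \<infinity>\<close> by auto
    then show "V_W lf lb \<xi> = \<infinity>"
      unfolding V_W_def by (intro Inf_eqI) (auto simp: top_ereal_def)
  qed
  obtain \<xi> where "(\<Sum>z. ennreal (real z * pmf \<xi> z)) < \<infinity>"
    "(\<Sum>z. ennreal (real z * ln (real z) * pmf \<xi> z)) = \<infinity>"
    by (rule exists_pmf_finite_mean_infinite_entropy)
  then have "V_W lf lb \<xi> \<noteq> rel_entropy \<xi> (xi_W lf lb)"
    using main by fastforce
  then show ?thesis using main by metis
qed

end
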